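(* Let $J,R,Q\in\mathbb R^{n\times n}$, $B\in\mathbb R^{n\times m}$ with $J^\top=-J$, $R=R^\top\succeq0$, $Q=Q^\top\succ0$ define a minimal port-Hamiltonian system with $A=(J-R)Q$ asymptotically stable and $C=B^\top Q$ ($(A,B)$ controllable, $(A,C)$ observable), which is balanced with respect to the solutions $\mathcal L_{\mathrm c},\mathcal M_{\mathrm o}$ of $$A\mathcal L_{\mathrm c}+\mathcal L_{\mathrm c}A^\top+2R=0,\qquad A^\top\mathcal M_{\mathrm o}+\mathcal M_{\mathrm o}A+C^\top C=0,$$ i.e. $\mathcal M_{\mathrm o}=\mathcal L_{\mathrm c}=\Pi=\mathrm{diag}(\Pi_1,\Pi_2)$ is diagonal with $\Pi_1=\mathrm{diag}(\pi_1,\dots,\pi_r)$, $\Pi_2=\mathrm{diag}(\pi_{r+1},\dots,\pi_n)$. Let $(\widehat A_r,\widehat B_r,\widehat C_r)$ be the reduced-order model of order $r$ obtained by truncation of $(A,B,C)$, and let $c>0$ be such that $cR\succeq\frac12BB^\top$. If $G(s)=C(sI_n-A)^{-1}B$ and $\widehat G_r(s)=\widehat C_r(sI_r-\widehat A_r)^{-1}\widehat B_r$ are the associated transfer functions, then $$\|G-\widehat G_r\|_{\mathcal H_\infty}\le2\sqrt c\sum_{i=r+1}^n\pi_i.$$ Moreover, the reduced-order model $(\widehat A_r,\widehat B_r,\widehat C_r)$ is port-Hamiltonian.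
   Context: Asymptotically stable: all eigenvalues of $A$ lie in the open left half plane. Truncation: $\widehat A_r$ is the leading $r\times r$ block of $A$, $\widehat B_r$ consists of the first $r$ rows of $B$, $\widehat C_r$ of the first $r$ columns of $C$. A system $(\mathcal A,\mathcal B,\mathcal C)$ is port-Hamiltonian if there are $\mathcal J=-\mathcal J^\top$, $\mathcal R=\mathcal R^\top\succeq0$, $\mathcal Q=\mathcal Q^\top\succ0$ with $\mathcal A=(\mathcal J-\mathcal R)\mathcal Q$, $\mathcal C=\mathcal B^\top\mathcal Q$. $\|F\|_{\mathcal H_\infty}=\sup_{z\in\mathbb C_+}\|F(z)\|_2$, with $\mathbb C_+$ the open right half plane and $\|\cdot\|_2$ the spectral norm. *)

theory Defs
  imports
    "Jordan_Normal_Form.Char_Poly"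
    "Jordan_Normal_Form.Gauss_Jordan_Elimination"
    "HOL-Analysis.L2_Norm"
    "HOL-Library.Extended_Real"
begin

text \<open>Real symmetric (semi)definiteness; symmetry is part of both notions.\<close>

definition pos_semidef :: "nat \<Rightarrow> real mat \<Rightarrow> bool" where
  "pos_semidef n M \<longleftrightarrow> M \<in> carrier_mat n n \<and> transpose_mat M = M \<and>
     (\<forall>v\<in>carrier_vec n. 0 \<le> v \<bullet> (M *\<^sub>v v))"

definition pos_def :: "nat \<Rightarrow> real mat \<Rightarrow> bool" where
  "pos_def n M \<longleftrightarrow> M \<in> carrier_mat n n \<and> transpose_mat M = M \<and>
     (\<forall>v\<in>carrier_vec n. v \<noteq> 0\<^sub>v n \<longrightarrow> 0 < v \<bullet> (M *\<^sub>v v))"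

definition asymptotically_stable :: "real mat \<Rightarrow> bool" where
  "asymptotically_stable A \<longleftrightarrow>
     (\<forall>z. eigenvalue (map_mat complex_of_real A) z \<longrightarrow> Re z < 0)"

text \<open>State dimension \<open>n\<close>, input and output dimension \<open>m\<close>.\<close>

definition ph_representation ::
  "nat \<Rightarrow> nat \<Rightarrow> real mat \<Rightarrow> real mat \<Rightarrow> real mat \<Rightarrow> real mat \<Rightarrow> real mat \<Rightarrow> real mat \<Rightarrow> bool" where
  "ph_representation n m J R Q A B C \<longleftrightarrow>
     J \<in> carrier_mat n n \<and> transpose_mat J = - J \<and>
     pos_semidef n R \<and> pos_def n Q \<and> B \<in> carrier_mat n m \<and>
     A = (J - R) * Q \<and> C = transpose_mat B * Q"

definition port_hamiltonian :: "nat \<Rightarrow> nat \<Rightarrow> real mat \<Rightarrow> real mat \<Rightarrow> real mat \<Rightarrow> bool" where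
  "port_hamiltonian n m A B C \<longleftrightarrow> (\<exists>J R Q. ph_representation n m J R Q A B C)"

text \<open>
  \<open>x\<close> solves \<open>x' = A x + f\<close> on \<open>[0, T]\<close>. The derivative is stated componentwise, since the
  type of vectors carries no topology.
\<close>

definition solves_lti ::
  "real mat \<Rightarrow> (real \<Rightarrow> real vec) \<Rightarrow> real \<Rightarrow> (real \<Rightarrow> real vec) \<Rightarrow> bool" where
  "solves_lti A f T x \<longleftrightarrow>
     (\<forall>t\<in>{0..T}. x t \<in> carrier_vec (dim_row A) \<and>
        (\<forall>i<dim_row A.
           ((\<lambda>s. x s $ i) has_real_derivative (A *\<^sub>v x t + f t) $ i) (at t within {0..T})))"

text \<open>Every state can be steered to every other state in any given time by a continuous input.\<close>

definition controllable :: "real mat \<Rightarrow> real mat \<Rightarrow> bool" where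
  "controllable A B \<longleftrightarrow>
     (\<forall>T>0. \<forall>x0\<in>carrier_vec (dim_row A). \<forall>x1\<in>carrier_vec (dim_row A).
        \<exists>u x. (\<forall>t. u t \<in> carrier_vec (dim_col B)) \<and>
          (\<forall>i<dim_col B. continuous_on {0..T} (\<lambda>t. u t $ i)) \<and>
          solves_lti A (\<lambda>t. B *\<^sub>v u t) T x \<and> x 0 = x0 \<and> x T = x1)"

text \<open>
  The output on any time interval determines the initial state. By linearity it is enough to
  consider zero input.
\<close>

definition observable :: "real mat \<Rightarrow> real mat \<Rightarrow> bool" where
  "observable A C \<longleftrightarrow>
     (\<forall>T>0. \<forall>x y.
        solves_lti A (\<lambda>t. 0\<^sub>v (dim_row A)) T x \<and> solves_lti A (\<lambda>t. 0\<^sub>v (dim_row A)) T y \<and>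
        (\<forall>t\<in>{0..T}. C *\<^sub>v x t = C *\<^sub>v y t) \<longrightarrow> x 0 = y 0)"

definition leading_block :: "nat \<Rightarrow> nat \<Rightarrow> 'a mat \<Rightarrow> 'a mat" where
  "leading_block k l M = mat k l (\<lambda>(i, j). M $$ (i, j))"

text \<open>
  \<open>C (s I - A)\<^sup>-\<^sup>1 B\<close>, where \<open>A\<close>, \<open>B\<close>, \<open>C\<close> are real and \<open>s\<close> is complex. The value is
  meaningful only if \<open>s\<close> is not an eigenvalue of \<open>A\<close>; for a port-Hamiltonian system this
  holds throughout the open right half plane.
\<close>

definition transfer_function ::
  "real mat \<Rightarrow> real mat \<Rightarrow> real mat \<Rightarrow> complex \<Rightarrow> complex mat" where
  "transfer_function A B C s =
     map_mat complex_of_real C *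
     the (mat_inverse (s \<cdot>\<^sub>m 1\<^sub>m (dim_row A) - map_mat complex_of_real A)) *
     map_mat complex_of_real B"

definition euclidean_norm :: "complex vec \<Rightarrow> real" where
  "euclidean_norm v = L2_set (\<lambda>i. cmod (v $ i)) {..<dim_vec v}"

text \<open>Taking the closed unit ball keeps the set nonempty for matrices without columns.\<close>

definition spectral_norm :: "complex mat \<Rightarrow> real" where
  "spectral_norm M =
     (SUP v\<in>{v \<in> carrier_vec (dim_col M). euclidean_norm v \<le> 1}. euclidean_norm (M *\<^sub>v v))"

text \<open>Extended-real valued, so that an unbounded function has norm \<open>\<infinity>\<close>.\<close>

definition hinf_norm :: "(complex \<Rightarrow> complex mat) \<Rightarrow> ereal" where
  "hinf_norm F = (SUP z\<in>{z. 0 < Re z}. ereal (spectral_norm (F z)))"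

end

theory Submission
  imports Defs "Jordan_Normal_Form.Schur_Decomposition"
begin

text \<open>
  Since \<open>A Q\<^sup>-\<^sup>1 + Q\<^sup>-\<^sup>1 A\<^sup>T = -2 R\<close> and Lyapunov equations for a stable \<open>A\<close> have a unique solution,
  \<open>Q = \<Pi>\<^sup>-\<^sup>1\<close> is diagonal; hence the leading blocks of \<open>J\<close>, \<open>R\<close>, \<open>Q\<close> represent the truncated system.

  For the error bound it suffices to remove one state at a time, at a fixed \<open>s\<close> with \<open>Re s > 0\<close>.
  Let \<open>x\<close> and \<open>z\<close> be the states of the systems of order \<open>k + 1\<close> and \<open>k\<close> for the input \<open>u\<close>, and let
  \<open>\<sigma>\<close> be the weight of the removed state. With \<open>z\<close> padded by \<open>0\<close>, the observability equation gives
  an estimate for the \<open>\<Pi>\<close>-energy of \<open>x - z\<close>, and \<open>c R \<ge> B B\<^sup>T / 2\<close> gives one for the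
  \<open>\<Pi>\<^sup>-\<^sup>1\<close>-energy of \<open>x + z\<close>. Adding \<open>\<sigma>\<^sup>2\<close> times the second to the first cancels the coupling term and
  leaves \<open>\<bar>y - y'\<bar>\<^sup>2 \<le> 4 c \<sigma>\<^sup>2 \<bar>u\<bar>\<^sup>2\<close>.
  The triangle inequality sums the steps.
\<close>

subsection \<open>Energy estimates for one removed state\<close>

text \<open>For a real matrix the cross terms between real and imaginary parts of \<open>h\<close>
  are purely imaginary. Complex energy estimates thus reduce to two real ones, also when
  \<open>M\<close> is not symmetric.\<close>

lemma Re_quadratic_form:
  fixes h :: "'a \<Rightarrow> complex" and M :: "'a \<Rightarrow> 'a \<Rightarrow> real"
  shows "Re (\<Sum>i\<in>I. cnj (h i) * (\<Sum>j\<in>I. of_real (M i j) * h j)) =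
    (\<Sum>i\<in>I. Re (h i) * (\<Sum>j\<in>I. M i j * Re (h j))) +
    (\<Sum>i\<in>I. Im (h i) * (\<Sum>j\<in>I. M i j * Im (h j)))"
  by (simp add: sum.distrib sum_distrib_left)

lemma cmod_sum_of_real_power2:
  fixes h :: "'a \<Rightarrow> complex" and b :: "'a \<Rightarrow> real"
  shows "(cmod (\<Sum>i\<in>I. of_real (b i) * h i))\<^sup>2 =
    (\<Sum>i\<in>I. b i * Re (h i))\<^sup>2 + (\<Sum>i\<in>I. b i * Im (h i))\<^sup>2"
  by (simp add: cmod_power2)

text \<open>Transposing the matrix does not change its quadratic form, so only the symmetric part
  contributes.\<close>

lemma quadratic_form_symmetrize:
  fixes M :: "'a \<Rightarrow> 'a \<Rightarrow> real"
  shows "2 * (\<Sum>i\<in>I. x i * (\<Sum>j\<in>I. M i j * x j)) =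
    (\<Sum>i\<in>I. x i * (\<Sum>j\<in>I. (M i j + M j i) * x j))"
proof -
  have "(\<Sum>i\<in>I. \<Sum>j\<in>I. x i * (M i j * x j)) = (\<Sum>i\<in>I. \<Sum>j\<in>I. x i * (M j i * x j))"
    by (subst sum.swap) (simp add: mult_ac)
  then show ?thesis
    by (simp add: sum_distrib_left distrib_left distrib_right sum.distrib)
qed

lemma quadratic_form_gram:
  fixes N :: "'b \<Rightarrow> 'a \<Rightarrow> real"
  shows "(\<Sum>i\<in>I. x i * (\<Sum>j\<in>I. (\<Sum>p\<in>P. N p i * N p j) * x j)) = (\<Sum>p\<in>P. (\<Sum>j\<in>I. N p j * x j)\<^sup>2)"
proof -
  have "(\<Sum>i\<in>I. x i * (\<Sum>j\<in>I. (\<Sum>p\<in>P. N p i * N p j) * x j)) =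
        (\<Sum>i\<in>I. \<Sum>p\<in>P. \<Sum>j\<in>I. (N p i * x i) * (N p j * x j))"
  proof (rule sum.cong[OF refl])
    fix i
    show "x i * (\<Sum>j\<in>I. (\<Sum>p\<in>P. N p i * N p j) * x j) =
      (\<Sum>p\<in>P. \<Sum>j\<in>I. (N p i * x i) * (N p j * x j))"
      by (subst sum.swap) (simp add: sum_distrib_left sum_distrib_right mult_ac)
  qed
  also have "\<dots> = (\<Sum>p\<in>P. \<Sum>i\<in>I. \<Sum>j\<in>I. (N p i * x i) * (N p j * x j))"
    by (rule sum.swap)
  finally show ?thesis by (simp add: power2_eq_square sum_product)
qed

text \<open>The Lyapunov equation says that twice the symmetric part of diag(d) \<open>A\<close> is
  minus the Gram matrix of \<open>N\<close>. As the weight is diagonal, entry (i,j) of the equation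
  involves only \<open>A i j\<close> and \<open>A j i\<close> from \<open>A\<close>; it therefore
  restricts to any smaller index set \<open>I\<close>, in particular to truncated systems.\<close>

lemma observability_identity:
  fixes A :: "'a \<Rightarrow> 'a \<Rightarrow> real" and N :: "'b \<Rightarrow> 'a \<Rightarrow> real" and d :: "'a \<Rightarrow> real" and h :: "'a \<Rightarrow> complex"
  assumes "\<And>i j. i \<in> I \<Longrightarrow> j \<in> I \<Longrightarrow> A j i * d j + d i * A i j + (\<Sum>p\<in>P. N p i * N p j) = 0"
  shows "2 * Re (\<Sum>i\<in>I. cnj (h i) * (\<Sum>j\<in>I. of_real (d i * A i j) * h j)) =
    - (\<Sum>p\<in>P. (cmod (\<Sum>j\<in>I. of_real (N p j) * h j))\<^sup>2)"
proof -
  have *: "2 * (\<Sum>i\<in>I. x i * (\<Sum>j\<in>I. (d i * A i j) * x j)) =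
      - (\<Sum>p\<in>P. (\<Sum>j\<in>I. N p j * x j)\<^sup>2)" for x
  proof -
    have "(\<Sum>i\<in>I. x i * (\<Sum>j\<in>I. (d i * A i j + d j * A j i) * x j))
       = (\<Sum>i\<in>I. x i * (\<Sum>j\<in>I. - (\<Sum>p\<in>P. N p i * N p j) * x j))"
      using assms by (intro sum.cong refl arg_cong2[of _ _ _ _ "(*)"]) (smt (verit) mult.commute)
    then show ?thesis
      by (simp add: quadratic_form_symmetrize[of x "\<lambda>i j. d i * A i j"]
          quadratic_form_gram[symmetric] sum_negf)
  qed
  show ?thesis
    unfolding Re_quadratic_form distrib_left *
    by (simp add: cmod_sum_of_real_power2 sum.distrib)
qed

text \<open>The skew part \<open>J\<close> drops out of the real quadratic forms. What is left is
  the dissipation given by \<open>R\<close>, which dominates the input energy by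
  \<open>RB\<close>.\<close>

lemma controllability_inequality:
  fixes R :: "'a \<Rightarrow> 'a \<Rightarrow> real" and B :: "'a \<Rightarrow> 'b \<Rightarrow> real" and h :: "'a \<Rightarrow> complex"
  assumes J: "\<And>i j. i \<in> I \<Longrightarrow> j \<in> I \<Longrightarrow> J j i = - J i j"
    and RB: "\<And>x. (\<Sum>l\<in>L. (\<Sum>i\<in>I. B i l * x i)\<^sup>2) \<le>
      2 * c * (\<Sum>i\<in>I. x i * (\<Sum>j\<in>I. R i j * x j))"
  shows "(\<Sum>l\<in>L. (cmod (\<Sum>i\<in>I. of_real (B i l) * h i))\<^sup>2) \<le>
    - (2 * c * Re (\<Sum>i\<in>I. cnj (h i) * (\<Sum>j\<in>I. of_real (J i j - R i j) * h j)))"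
proof -
  have *: "(\<Sum>i\<in>I. x i * (\<Sum>j\<in>I. (J i j - R i j) * x j)) =
      - (\<Sum>i\<in>I. x i * (\<Sum>j\<in>I. R i j * x j))" for x
  proof -
    have "2 * (\<Sum>i\<in>I. x i * (\<Sum>j\<in>I. J i j * x j)) = 0"
    proof -
      have "J i j + J j i = 0" if "i \<in> I" "j \<in> I" for i j
        using J[OF that] by simp
      then show ?thesis unfolding quadratic_form_symmetrize by simp
    qed
    then show ?thesis by (simp add: left_diff_distrib right_diff_distrib sum_subtractf)
  qed
  show ?thesis
    unfolding Re_quadratic_form *
    using RB[of "\<lambda>i. Re (h i)"] RB[of "\<lambda>i. Im (h i)"]
    by (simp add: cmod_sum_of_real_power2 sum.distrib right_diff_distrib)
qed

text \<open>Young's inequality, from expanding the square of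
  \<open>cmod (a - 2 c u)\<close>.\<close>

lemma Re_cnj_mult_le:
  fixes a u :: complex
  assumes "c > 0"
  shows "4 * Re (cnj a * u) \<le> (cmod a)\<^sup>2 / c + 4 * c * (cmod u)\<^sup>2"
proof -
  have "0 \<le> (cmod (a - of_real (2 * c) * u))\<^sup>2 / c" using assms by simp
  also have "\<dots> = (cmod a)\<^sup>2 / c + 4 * c * (cmod u)\<^sup>2 - 4 * Re (cnj a * u)"
    unfolding cmod_power2 using assms by (simp add: field_simps power2_eq_square)
  finally show ?thesis by simp
qed

text \<open>The states \<open>x\<close> and \<open>z\<close> are given as solutions of the resolvent
  equations; their existence is a separate matter. Both Gramian conditions enter only as energy
  inequalities for arbitrary complex vectors.\<close>

lemma truncation_step:
  fixes A B N :: "nat \<Rightarrow> nat \<Rightarrow> real" and d :: "nat \<Rightarrow> real" and s :: complex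
  assumes s: "Re s \<ge> 0" and d: "\<And>i. i \<le> k \<Longrightarrow> d i > 0" and c: "c > 0"
    and x: "\<And>i. i < Suc k \<Longrightarrow>
      s * x i = (\<Sum>j<Suc k. of_real (A i j) * x j) + (\<Sum>l<m. of_real (B i l) * u l)"
    and z: "\<And>i. i < k \<Longrightarrow>
      s * z i = (\<Sum>j<k. of_real (A i j) * z j) + (\<Sum>l<m. of_real (B i l) * u l)"
    and obs: "\<And>h. 2 * Re (\<Sum>i<Suc k. cnj (h i) * (\<Sum>j<Suc k. of_real (d i * A i j) * h j)) \<le>
      - (\<Sum>p<q. (cmod (\<Sum>j<Suc k. of_real (N p j) * h j))\<^sup>2)"
    and ctr: "\<And>h. (\<Sum>l<m. (cmod (\<Sum>i<Suc k. of_real (B i l) * h i))\<^sup>2) \<le>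
      - (2 * c * Re (\<Sum>i<Suc k. cnj (h i) * (\<Sum>j<Suc k. of_real (A i j * d j) * h j)))"
  shows "(\<Sum>p<q. (cmod ((\<Sum>j<Suc k. of_real (N p j) * x j) - (\<Sum>j<k. of_real (N p j) * z j)))\<^sup>2)
    \<le> 4 * c * (d k)\<^sup>2 * (\<Sum>l<m. (cmod (u l))\<^sup>2)"
proof -
  text \<open>
    Pad \<open>z\<close> with \<open>0\<close>. The padded state fails the full equation only in the last coordinate, by \<open>w\<close>,
    and \<open>w\<close> enters the equations of \<open>e = x - \<zeta>\<close> and \<open>g = x + \<zeta>\<close> with opposite signs.
    Both have last coordinate \<open>x k\<close>, so \<open>w\<close> cancels between the two energy estimates.
  \<close>
  define \<zeta> where "\<zeta> j = (if j < k then z j else 0)" for j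
  define e where "e j = x j - \<zeta> j" for j
  define g where "g j = x j + \<zeta> j" for j
  \<comment> \<open>\<open>h\<close> is the dual state diag(d)^-1 \<open>g\<close>. Pairing it with
    \<open>g\<close> gives the inverse-weighted energy, and \<open>A\<close> applied to
    \<open>g\<close> becomes \<open>A\<close> diag(d) applied to \<open>h\<close>, the form that
    \<open>ctr\<close> bounds.\<close>
  define h where "h j = g j / of_real (d j)" for j
  define bu where "bu i = (\<Sum>l<m. of_real (B i l) * u l)" for i
  define w where "w = (\<Sum>j<k. of_real (A k j) * z j) + bu k"
  let ?\<delta> = "\<lambda>i. if i = k then w else 0"
  have \<zeta>: "s * \<zeta> i = (\<Sum>j<Suc k. of_real (A i j) * \<zeta> j) + bu i - ?\<delta> i" if "i < Suc k" for i
    using that z[of i] by (auto simp: \<zeta>_def w_def bu_def less_Suc_eq)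
  have e: "s * e i = (\<Sum>j<Suc k. of_real (A i j) * e j) + ?\<delta> i" if "i < Suc k" for i
    using x[OF that] \<zeta>[OF that]
    by (simp add: e_def bu_def right_diff_distrib sum_subtractf del: sum.lessThan_Suc)
  have g: "s * g i = (\<Sum>j<Suc k. of_real (A i j) * g j) + 2 * bu i - ?\<delta> i" if "i < Suc k" for i
    using x[OF that] \<zeta>[OF that]
    by (simp add: g_def bu_def distrib_left sum.distrib del: sum.lessThan_Suc)
  have xk: "e k = x k" "g k = x k" by (simp_all add: e_def g_def \<zeta>_def)
  have split: "(\<Sum>i<Suc k. cnj (f i) * (v i + ?\<delta> i)) = (\<Sum>i<Suc k. cnj (f i) * v i) + cnj (f k) * w"
    for f v by (simp add: algebra_simps)

  \<comment> \<open>Testing the equation of \<open>e\<close> with its weighted conjugate yields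
    \<open>s\<close> times a nonnegative energy, whose real part is nonnegative as
    \<open>Re s \<ge> 0\<close>.\<close>
  have "(\<Sum>i<Suc k. cnj (e i) * (of_real (d i) * (s * e i))) = s * of_real (\<Sum>i<Suc k. d i * (cmod (e i))\<^sup>2)"
    unfolding of_real_sum of_real_mult complex_norm_square sum_distrib_left
    by (intro sum.cong refl) (simp only: mult_ac)
  moreover have "0 \<le> (\<Sum>i<Suc k. d i * (cmod (e i))\<^sup>2)"
    using d by (intro sum_nonneg) (simp add: less_Suc_eq_le less_imp_le)
  ultimately have E0: "Re (\<Sum>i<Suc k. cnj (e i) * (of_real (d i) * (s * e i))) \<ge> 0"
    using s by (simp del: sum.lessThan_Suc of_real_sum)
  have "(\<Sum>i<Suc k. cnj (e i) * (of_real (d i) * (s * e i))) =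
    (\<Sum>i<Suc k. cnj (e i) * (\<Sum>j<Suc k. of_real (d i * A i j) * e j)) + of_real (d k) * (cnj (x k) * w)"
  proof -
    have "(\<Sum>i<Suc k. cnj (e i) * (of_real (d i) * (s * e i))) =
      (\<Sum>i<Suc k. cnj (of_real (d i) * e i) * ((\<Sum>j<Suc k. of_real (A i j) * e j) + ?\<delta> i))"
      by (intro sum.cong refl) (simp add: e del: sum.lessThan_Suc)
    then show ?thesis unfolding split
      by (simp add: sum_distrib_left mult_ac xk del: sum.lessThan_Suc)
  qed
  with E0 obs[of e]
  have E: "(\<Sum>p<q. (cmod (\<Sum>j<Suc k. of_real (N p j) * e j))\<^sup>2) \<le> 2 * d k * Re (cnj (x k) * w)"
    by (simp del: sum.lessThan_Suc)

  have "(\<Sum>i<Suc k. cnj (h i) * (s * g i)) = s * of_real (\<Sum>i<Suc k. (cmod (g i))\<^sup>2 / d i)"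
    unfolding of_real_sum of_real_divide complex_norm_square sum_distrib_left h_def
    by (intro sum.cong refl) simp
  moreover have "0 \<le> (\<Sum>i<Suc k. (cmod (g i))\<^sup>2 / d i)"
    using d by (intro sum_nonneg) (simp add: less_Suc_eq_le less_imp_le)
  ultimately have G0: "Re (\<Sum>i<Suc k. cnj (h i) * (s * g i)) \<ge> 0"
    using s by (simp del: sum.lessThan_Suc of_real_sum)
  \<comment> \<open>The coupling with \<open>w\<close> now has weight \<open>- 1 / d k\<close>,
    against \<open>+ d k\<close> in the estimate for \<open>e\<close>. The quotient of these weights
    is the origin of the factor \<open>(d k)\<^sup>2\<close>.\<close>
  have G1: "(\<Sum>i<Suc k. cnj (h i) * (s * g i)) =
    (\<Sum>i<Suc k. cnj (h i) * (\<Sum>j<Suc k. of_real (A i j * d j) * h j)) + 2 * (\<Sum>i<Suc k. cnj (h i) * bu i)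
      - cnj (x k) * w / of_real (d k)"
  proof -
    have "(\<Sum>j<Suc k. of_real (A i j) * g j) = (\<Sum>j<Suc k. of_real (A i j * d j) * h j)" for i
      using d less_imp_neq[OF d] by (intro sum.cong refl) (auto simp: h_def less_Suc_eq_le)
    then have "(\<Sum>i<Suc k. cnj (h i) * (s * g i)) =
      (\<Sum>i<Suc k. cnj (h i) * ((\<Sum>j<Suc k. of_real (A i j * d j) * h j) + 2 * bu i - ?\<delta> i))"
      by (intro sum.cong refl) (simp add: g del: sum.lessThan_Suc)
    also have "\<dots> = (\<Sum>i<Suc k. cnj (h i) * ((\<Sum>j<Suc k. of_real (A i j * d j) * h j) + 2 * bu i))
      - (\<Sum>i<Suc k. cnj (h i) * ?\<delta> i)"
      by (simp only: right_diff_distrib sum_subtractf)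
    also have "(\<Sum>i<Suc k. cnj (h i) * ?\<delta> i) = cnj (h k) * w"
      by simp
    finally show ?thesis
      by (simp add: distrib_left sum.distrib sum_distrib_left mult_ac h_def xk del: sum.lessThan_Suc)
  qed
  \<comment> \<open>\<open>a\<close> is the transpose of \<open>B\<close> applied to
    \<open>h\<close>, so the input term pairs \<open>a\<close> with \<open>u\<close>. The weight in
    \<open>Re_cnj_mult_le\<close> is such that the resulting
    \<open>(cmod (a l))\<^sup>2 / c\<close>, summed over \<open>l\<close>, is exactly what
    \<open>ctr\<close> lets the dissipation absorb.\<close>
  define a where "a l = (\<Sum>i<Suc k. of_real (B i l) * h i)" for l
  have "(\<Sum>i<Suc k. cnj (h i) * bu i) = (\<Sum>l<m. cnj (a l) * u l)"
    unfolding bu_def a_def cnj_sum sum_distrib_left sum_distrib_right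
    by (subst sum.swap) (simp add: mult_ac del: sum.lessThan_Suc)
  then have "4 * Re (\<Sum>i<Suc k. cnj (h i) * bu i) = (\<Sum>l<m. 4 * Re (cnj (a l) * u l))"
    by (simp add: sum_distrib_left del: sum.lessThan_Suc)
  also have "\<dots> \<le> (\<Sum>l<m. (cmod (a l))\<^sup>2 / c + 4 * c * (cmod (u l))\<^sup>2)"
    by (intro sum_mono Re_cnj_mult_le c)
  also have "\<dots> = (\<Sum>l<m. (cmod (a l))\<^sup>2) / c + 4 * c * (\<Sum>l<m. (cmod (u l))\<^sup>2)"
    by (simp add: sum.distrib sum_distrib_left sum_divide_distrib)
  also have "(\<Sum>l<m. (cmod (a l))\<^sup>2) / c \<le>
    - 2 * Re (\<Sum>i<Suc k. cnj (h i) * (\<Sum>j<Suc k. of_real (A i j * d j) * h j))"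
    using ctr[of h] c unfolding a_def by (simp add: field_simps del: sum.lessThan_Suc)
  moreover have "2 * (Re (cnj (x k) * w) / d k) \<le>
    2 * Re (\<Sum>i<Suc k. cnj (h i) * (\<Sum>j<Suc k. of_real (A i j * d j) * h j)) +
    4 * Re (\<Sum>i<Suc k. cnj (h i) * bu i)"
  proof -
    have Re2: "Re (a + 2 * b - v / of_real t) = Re a + 2 * Re b - Re v / t" for a b v t
      by (simp add: Re_divide_of_real)
    show ?thesis using G0 unfolding G1 Re2 by linarith
  qed
  ultimately have "2 * (Re (cnj (x k) * w) / d k) \<le> 4 * c * (\<Sum>l<m. (cmod (u l))\<^sup>2)"
    by linarith
  \<comment> \<open>Scaling by \<open>(d k)\<^sup>2\<close> turns the coupling term into the
    right-hand side of \<open>E\<close>.\<close>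
  from mult_left_mono[OF this, of "(d k)\<^sup>2"]
  have "2 * d k * Re (cnj (x k) * w) \<le> 4 * c * (d k)\<^sup>2 * (\<Sum>l<m. (cmod (u l))\<^sup>2)"
    using d[of k] by (simp only: power2_eq_square) (simp add: mult_ac)
  moreover have "(\<Sum>j<Suc k. of_real (N p j) * e j) =
    (\<Sum>j<Suc k. of_real (N p j) * x j) - (\<Sum>j<k. of_real (N p j) * z j)" for p
    by (simp add: e_def \<zeta>_def right_diff_distrib sum_subtractf)
  ultimately show ?thesis using E by (simp del: sum.lessThan_Suc)
qed

text \<open>The weighted energy of a solution of \<open>s x = A x\<close>, multiplied by
  \<open>Re s\<close>, is the real part of a form that \<open>obs\<close> makes nonpositive. Hence
  the energy is zero. This excludes eigenvalues in the open right half plane for truncated blocks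
  too, whose stability is not a hypothesis.\<close>

lemma resolvent_injective:
  fixes A N :: "nat \<Rightarrow> nat \<Rightarrow> real" and d :: "nat \<Rightarrow> real" and s :: complex
  assumes s: "Re s > 0" and d: "\<And>i. i < k \<Longrightarrow> d i > 0"
    and x: "\<And>i. i < k \<Longrightarrow> s * x i = (\<Sum>j<k. of_real (A i j) * x j)"
    and obs: "\<And>h. 2 * Re (\<Sum>i<k. cnj (h i) * (\<Sum>j<k. of_real (d i * A i j) * h j)) \<le> 0"
    and i: "i < k"
  shows "x i = 0"
proof -
  have "(\<Sum>i<k. cnj (x i) * (\<Sum>j<k. of_real (d i * A i j) * x j)) =
    (\<Sum>i<k. of_real (d i) * cnj (x i) * (s * x i))"
    by (intro sum.cong refl) (simp add: x sum_distrib_left mult_ac)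
  also have "\<dots> = s * of_real (\<Sum>i<k. d i * (cmod (x i))\<^sup>2)"
    unfolding of_real_sum of_real_mult complex_norm_square sum_distrib_left
    by (intro sum.cong refl) (simp only: mult_ac)
  finally have "Re s * (\<Sum>i<k. d i * (cmod (x i))\<^sup>2) \<le> 0"
    using obs[of x] by simp
  then have "(\<Sum>i<k. d i * (cmod (x i))\<^sup>2) \<le> 0"
    using s by (simp add: mult_le_0_iff)
  moreover have "(\<Sum>i<k. d i * (cmod (x i))\<^sup>2) \<ge> 0"
    using d by (intro sum_nonneg) (simp add: less_imp_le)
  ultimately have "\<forall>i\<in>{..<k}. d i * (cmod (x i))\<^sup>2 = 0"
    by (subst sum_nonneg_eq_0_iff[symmetric]) (auto simp: d less_imp_le)
  then show ?thesis using i d[of i] by force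
qed

subsection \<open>Uniqueness of the Lyapunov solution\<close>

text \<open>A Schur form \<open>T\<close> of \<open>B\<close> turns the equation into
  \<open>A * Y + Y * T = 0\<close> with \<open>Y = X * P\<close>. Once the columns before
  \<open>k\<close> vanish, column \<open>k\<close> solves \<open>A y = - T_kk y\<close>. If it were
  nonzero, \<open>- T_kk\<close> would be an eigenvalue of \<open>A\<close> while
  \<open>T_kk\<close> is one of \<open>B\<close>, against \<open>ev\<close>.\<close>

lemma sylvester_homogeneous_eq_zero:
  fixes A B X :: "complex mat"
  assumes A: "A \<in> carrier_mat n n" and B: "B \<in> carrier_mat n n" and X: "X \<in> carrier_mat n n"
    and eq: "A * X + X * B = 0\<^sub>m n n"
    and ev: "\<And>a b. eigenvalue A a \<Longrightarrow> eigenvalue B b \<Longrightarrow> a + b \<noteq> 0"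
  shows "X = 0\<^sub>m n n"
proof -
  obtain es where es: "char_poly B = (\<Prod>e\<leftarrow>es. [:- e, 1:])"
    using char_poly_factorized[OF B] by blast
  obtain T P Q where dec: "schur_decomposition B es = (T, P, Q)"
    using prod_cases3 by blast
  from schur_decomposition[OF B es dec]
  have sim: "similar_mat_wit B T P Q" and ut: "upper_triangular T" and diag: "diag_mat T = es"
    by auto
  note w = similar_mat_witD2[OF B sim]
  define Y where "Y = X * P"
  have Y[simp]: "Y \<in> carrier_mat n n" unfolding Y_def by (rule mult_carrier_mat[OF X w(6)])
  have "X * B * P = X * P * T"
  proof -
    have "X * B * P = X * (B * P)"
      using X B w(6) by (rule assoc_mult_mat)
    also have "B * P = P * T * (Q * P)"
      unfolding w(3) using mult_carrier_mat[OF w(6,5)] w(7,6) by (rule assoc_mult_mat)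
    also have "\<dots> = P * T"
      unfolding w(2) by (rule right_mult_one_mat[OF mult_carrier_mat[OF w(6,5)]])
    also have "X * (P * T) = X * P * T"
      using X w(6,5) by (rule assoc_mult_mat[symmetric])
    finally show ?thesis .
  qed
  moreover have "(A * X + X * B) * P = A * Y + X * B * P"
    unfolding Y_def
    using add_mult_distrib_mat[OF mult_carrier_mat[OF A X] mult_carrier_mat[OF X B] w(6)]
      assoc_mult_mat[OF A X w(6)] by simp
  ultimately have YT: "A * Y + Y * T = 0\<^sub>m n n"
    unfolding eq Y_def using left_mult_zero_mat[OF w(6)] by simp
  text \<open>\<open>T\<close> is upper triangular, so the columns of \<open>Y\<close> vanish one after the other.\<close>
  have eqn: "(\<Sum>j<n. A $$ (i,j) * Y $$ (j,k)) + (\<Sum>j<n. Y $$ (i,j) * T $$ (j,k)) = 0"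
    if "i < n" "k < n" for i k
    using arg_cong[OF YT, of "\<lambda>M. M $$ (i,k)"] that
    using carrier_matD[OF A] carrier_matD[OF Y] carrier_matD[OF w(5)]
    by (simp add: scalar_prod_def atLeast0LessThan)
  have "\<forall>i<n. Y $$ (i,k) = 0" if "k < n" for k
    using that
  proof (induction k rule: less_induct)
    case (less k)
    \<comment> \<open>Terms with \<open>j < k\<close> vanish by induction, those with
      \<open>k < j\<close> by triangularity.\<close>
    have "(\<Sum>j<n. Y $$ (i,j) * T $$ (j,k)) = Y $$ (i,k) * T $$ (k,k)" if "i < n" for i
    proof -
      have "(\<Sum>j<n. Y $$ (i,j) * T $$ (j,k)) = (\<Sum>j<n. if j = k then Y $$ (i,k) * T $$ (k,k) else 0)"
      proof (intro sum.cong refl)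
        fix j assume j: "j \<in> {..<n}"
        consider "j < k" | "j = k" | "k < j" by linarith
        then show "Y $$ (i,j) * T $$ (j,k) = (if j = k then Y $$ (i,k) * T $$ (k,k) else 0)"
          using less.IH[of j] less.prems upper_triangularD[OF ut, of k j] j \<open>i < n\<close> carrier_matD[OF w(5)]
          by cases auto
      qed
      then show ?thesis using less.prems by simp
    qed
    note YT_k = this
    have *: "(\<Sum>j<n. A $$ (i,j) * Y $$ (j,k)) = - T $$ (k,k) * Y $$ (i,k)" if "i < n" for i
      using eqn[OF that less.prems] YT_k[OF that] by (simp add: add_eq_0_iff2 mult.commute)
    have "A *\<^sub>v col Y k = (- T $$ (k,k)) \<cdot>\<^sub>v col Y k"
      using * less.prems carrier_matD[OF A] carrier_matD[OF Y]
      by (intro eq_vecI) (auto simp: scalar_prod_def atLeast0LessThan)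
    moreover have "eigenvalue B (T $$ (k,k))"
    proof -
      have "T $$ (k,k) \<in> set es"
        using less.prems carrier_matD[OF w(5)] unfolding diag[symmetric] diag_mat_def by auto
      then show ?thesis
        unfolding eigenvalue_root_char_poly[OF B] es poly_prod_list by (auto simp: prod_list_zero_iff image_iff)
    qed
    ultimately have "col Y k = 0\<^sub>v n"
      using ev[of "- T $$ (k,k)" "T $$ (k,k)"] carrier_matD[OF A] carrier_matD[OF Y] less.prems
      unfolding eigenvalue_def eigenvector_def
      by (metis add.left_inverse carrier_vecI dim_col)
    then have "col Y k $ i = 0" if "i < n" for i using that by simp
    then show ?case
      using less.prems carrier_matD[OF Y] by simp
  qed
  then have "Y = 0\<^sub>m n n"
    using carrier_matD[OF Y] by (intro eq_matI) auto
  then have "X * (P * Q) = 0\<^sub>m n n"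
    unfolding Y_def using assoc_mult_mat[OF X w(6,7)] left_mult_zero_mat[OF w(7)] by simp
  then show ?thesis using w(1) right_mult_one_mat[OF X] by simp
qed

text \<open>Over the complex numbers this is a Sylvester equation. \<open>A\<close> and its
  transpose share their eigenvalues, all with negative real part, so no two of them sum to
  zero.\<close>

lemma lyapunov_homogeneous_eq_zero:
  assumes A: "A \<in> carrier_mat n n" and X: "X \<in> carrier_mat n n"
    and stable: "asymptotically_stable A"
    and eq: "A * X + X * transpose_mat A = 0\<^sub>m n n"
  shows "X = 0\<^sub>m n n"
proof -
  let ?c = "map_mat complex_of_real"
  have "?c A * ?c X + ?c X * ?c (transpose_mat A) = ?c (A * X + X * transpose_mat A)"
    using A X by (intro eq_matI) (auto simp: scalar_prod_def)
  also have "\<dots> = 0\<^sub>m n n" unfolding eq by auto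
  finally have eq': "?c A * ?c X + ?c X * transpose_mat (?c A) = 0\<^sub>m n n"
    by (simp add: map_mat_transpose)
  have cA: "?c A \<in> carrier_mat n n" using A by simp
  have "eigenvalue (transpose_mat (?c A)) z \<longleftrightarrow> eigenvalue (?c A) z" for z
    using eigenvalue_root_char_poly[OF cA] eigenvalue_root_char_poly[OF transpose_carrier_mat[THEN iffD2, OF cA]]
    by (simp add: char_poly_transpose_mat[OF cA])
  then have "a + b \<noteq> 0" if "eigenvalue (?c A) a" "eigenvalue (transpose_mat (?c A)) b" for a b
    using that stable unfolding asymptotically_stable_def
    by (metis add_neg_neg less_irrefl plus_complex.sel(1) zero_complex.sel(1))
  then have "?c X = 0\<^sub>m n n"
    by (intro sylvester_homogeneous_eq_zero[OF cA _ _ eq']) (use A X in auto)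
  then show ?thesis
    using X by (auto simp: mat_eq_iff)
qed

lemma pos_def_imp_inverse:
  assumes "pos_def n Q"
  obtains P where "P \<in> carrier_mat n n" "Q * P = 1\<^sub>m n" "P * Q = 1\<^sub>m n" "transpose_mat P = P"
proof -
  have Q: "Q \<in> carrier_mat n n" and sym: "transpose_mat Q = Q" using assms by (auto simp: pos_def_def)
  have "det Q \<noteq> 0"
    using assms unfolding pos_def_def det_0_iff_vec_prod_zero_field[OF Q]
    by (metis order_less_irrefl scalar_prod_right_zero)
  then obtain P where "mat_inverse Q = Some P"
    using mat_inverse(1)[OF Q, of "()"] det_non_zero_imp_unit[OF Q, of "()"] by (cases "mat_inverse Q") auto
  from mat_inverse(2)[OF Q this]
  have P: "P \<in> carrier_mat n n" "Q * P = 1\<^sub>m n" "P * Q = 1\<^sub>m n" by auto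
  have "transpose_mat P * Q = 1\<^sub>m n"
    using arg_cong[OF P(2), of transpose_mat] transpose_mult[OF Q P(1)] sym by simp
  moreover have "transpose_mat P * Q * P = transpose_mat P * (Q * P)"
    using P(1) Q by (intro assoc_mult_mat) auto
  ultimately have "transpose_mat P = P"
    using P(1) right_mult_one_mat[of "transpose_mat P" n n] by (simp add: P(2))
  then show thesis using that P by blast
qed

text \<open>The inverse \<open>P\<close> of \<open>Q\<close> solves the same equation:
  \<open>A * P = J - R\<close> and its transpose \<open>- J - R\<close> add up to
  \<open>- 2 R\<close>. So \<open>L - P\<close> solves the homogeneous equation.\<close>

lemma controllability_gramian_eq_inverse:
  assumes ph: "ph_representation n m J R Q A B C"
    and stable: "asymptotically_stable A"
    and L: "L \<in> carrier_mat n n" "A * L + L * transpose_mat A + 2 \<cdot>\<^sub>m R = 0\<^sub>m n n"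
  shows "Q * L = 1\<^sub>m n"
proof -
  have J: "J \<in> carrier_mat n n" "transpose_mat J = - J"
    and R: "R \<in> carrier_mat n n" "transpose_mat R = R"
    and Q: "pos_def n Q" and Qc: "Q \<in> carrier_mat n n" "transpose_mat Q = Q" and A_eq: "A = (J - R) * Q"
    using ph by (auto simp: ph_representation_def pos_semidef_def pos_def_def)
  obtain P where P: "P \<in> carrier_mat n n" "Q * P = 1\<^sub>m n" "P * Q = 1\<^sub>m n" "transpose_mat P = P"
    using pos_def_imp_inverse[OF Q] .
  have JR: "J - R \<in> carrier_mat n n" by (rule minus_carrier_mat[OF R(1)])
  have A: "A \<in> carrier_mat n n" using A_eq JR Qc by auto
  have AP: "A * P = J - R"
    unfolding A_eq using assoc_mult_mat[OF JR Qc(1) P(1)] P(2) right_mult_one_mat[OF JR] by simp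
  have "P * transpose_mat A = transpose_mat (A * P)"
    using transpose_mult[OF A P(1)] P(4) by simp
  also have "\<dots> = - J - R"
    unfolding AP using J R by (simp add: transpose_minus[of _ n n])
  finally have PA: "P * transpose_mat A = - J - R" .
  have "A * (L - P) + (L - P) * transpose_mat A =
    (A * L + L * transpose_mat A) - (A * P + P * transpose_mat A)"
    using A L(1) P(1)
    by (intro eq_matI) (auto simp: mult_minus_distrib_mat[of _ n n _ n] minus_mult_distrib_mat[of _ n n _ _ n])
  also have "A * P + P * transpose_mat A = - (2 \<cdot>\<^sub>m R)"
    unfolding AP PA using J(1) R(1) by (intro eq_matI) auto
  also have "(A * L + L * transpose_mat A) - - (2 \<cdot>\<^sub>m R) = A * L + L * transpose_mat A + 2 \<cdot>\<^sub>m R"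
    using A L(1) R(1) by (intro eq_matI) auto
  finally have "A * (L - P) + (L - P) * transpose_mat A = 0\<^sub>m n n"
    using L(2) by simp
  from lyapunov_homogeneous_eq_zero[OF A minus_carrier_mat[OF P(1)] stable this]
  have "L - P = 0\<^sub>m n n" .
  then have "L = P"
    using L(1) P(1) by (auto simp: mat_eq_iff)
  then show ?thesis using P(2) by simp
qed

subsection \<open>Leading blocks and transfer functions\<close>

lemma index_mult_mat_sum:
  assumes "M \<in> carrier_mat a b" "N \<in> carrier_mat b d" "i < a" "j < d"
  shows "(M * N) $$ (i,j) = (\<Sum>l<b. M $$ (i,l) * N $$ (l,j))"
  using assms by (auto simp: scalar_prod_def atLeast0LessThan)

lemma index_mult_mat_vec_sum:
  assumes "M \<in> carrier_mat a b" "v \<in> carrier_vec b" "i < a"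
  shows "(M *\<^sub>v v) $ i = (\<Sum>l<b. M $$ (i,l) * v $ l)"
  using assms by (auto simp: scalar_prod_def atLeast0LessThan)

text \<open>A vector padded by zeros sees only the leading block; in this way leading blocks inherit
  (semi)definiteness.\<close>

lemma quadratic_form_leading_block:
  fixes M :: "real mat"
  assumes M: "M \<in> carrier_mat n n" and k: "k \<le> n"
  shows "vec n (\<lambda>i. if i < k then x i else 0) \<bullet> (M *\<^sub>v vec n (\<lambda>i. if i < k then x i else 0)) =
    (\<Sum>i<k. x i * (\<Sum>j<k. M $$ (i,j) * x j))" (is "?v \<bullet> _ = _")
proof -
  have trunc: "(\<Sum>i<n. (if i < k then f i else 0)) = (\<Sum>i<k. f i)" for f :: "nat \<Rightarrow> real"
    using k by (intro sum.mono_neutral_cong_right) auto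
  have "(M *\<^sub>v ?v) $ i = (\<Sum>j<k. M $$ (i,j) * x j)" if "i < n" for i
  proof -
    have "(M *\<^sub>v ?v) $ i = (\<Sum>j<n. if j < k then M $$ (i,j) * x j else 0)"
      unfolding index_mult_mat_vec_sum[OF M vec_carrier that] by (intro sum.cong) auto
    then show ?thesis by (simp add: trunc)
  qed
  then have "?v \<bullet> (M *\<^sub>v ?v) = (\<Sum>i<n. if i < k then x i * (\<Sum>j<k. M $$ (i,j) * x j) else 0)"
    using M by (auto simp: scalar_prod_def atLeast0LessThan intro!: sum.cong)
  then show ?thesis by (simp add: trunc)
qed

lemma pos_semidef_leading_sum:
  assumes "pos_semidef n M" "k \<le> n"
  shows "0 \<le> (\<Sum>i<k. x i * (\<Sum>j<k. M $$ (i,j) * x j))"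
proof -
  have M: "M \<in> carrier_mat n n" using assms(1) by (simp add: pos_semidef_def)
  show ?thesis
    unfolding quadratic_form_leading_block[OF M assms(2), symmetric]
    using assms(1) unfolding pos_semidef_def by (blast intro: vec_carrier)
qed

lemma leading_block_carrier [simp]: "leading_block k l M \<in> carrier_mat k l"
  by (simp add: leading_block_def)

lemma leading_block_index [simp]:
  "i < k \<Longrightarrow> j < l \<Longrightarrow> leading_block k l M $$ (i,j) = M $$ (i,j)"
  by (simp add: leading_block_def)

lemma leading_block_dim [simp]:
  "dim_row (leading_block k l M) = k" "dim_col (leading_block k l M) = l"
  by (simp_all add: leading_block_def)

lemma leading_block_self: "M \<in> carrier_mat k l \<Longrightarrow> leading_block k l M = M"
  by (intro eq_matI) auto

lemma quadratic_form_leading_block_vec: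
  fixes M :: "real mat"
  assumes "v \<in> carrier_vec k"
  shows "v \<bullet> (leading_block k k M *\<^sub>v v) = (\<Sum>i<k. v $ i * (\<Sum>j<k. M $$ (i,j) * v $ j))"
proof -
  have "vec k (\<lambda>i. if i < k then v $ i else 0) = v"
    using assms by (intro eq_vecI) auto
  then show ?thesis
    using quadratic_form_leading_block[of "leading_block k k M" k k "($) v"] by simp
qed

lemma transpose_leading_block:
  assumes "M \<in> carrier_mat a b" "k \<le> a" "l \<le> b"
  shows "transpose_mat (leading_block k l M) = leading_block l k (transpose_mat M)"
  using assms by (intro eq_matI) auto

lemma pos_semidef_leading_block:
  assumes "pos_semidef n M" "k \<le> n"
  shows "pos_semidef k (leading_block k k M)"
proof -
  have M: "M \<in> carrier_mat n n" "transpose_mat M = M" using assms by (auto simp: pos_semidef_def)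
  then show ?thesis
    unfolding pos_semidef_def
    using transpose_leading_block[OF M(1) assms(2,2)] pos_semidef_leading_sum[OF assms]
    by (auto simp: quadratic_form_leading_block_vec)
qed

lemma pos_def_leading_block:
  assumes "pos_def n M" "k \<le> n"
  shows "pos_def k (leading_block k k M)"
proof -
  have M: "M \<in> carrier_mat n n" "transpose_mat M = M" using assms by (auto simp: pos_def_def)
  have "0 < v \<bullet> (leading_block k k M *\<^sub>v v)" if v: "v \<in> carrier_vec k" "v \<noteq> 0\<^sub>v k" for v
  proof -
    let ?w = "vec n (\<lambda>i. if i < k then v $ i else 0)"
    obtain i where i: "i < k" "v $ i \<noteq> 0" using v by (auto simp: vec_eq_iff)
    then have "?w $ i \<noteq> 0\<^sub>v n $ i" using assms(2) by simp
    then have "?w \<noteq> 0\<^sub>v n" by metis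
    then have "0 < ?w \<bullet> (M *\<^sub>v ?w)"
      using assms(1) vec_carrier unfolding pos_def_def by blast
    then show ?thesis
      using quadratic_form_leading_block[OF M(1) assms(2), of "\<lambda>i. v $ i"]
      by (simp add: quadratic_form_leading_block_vec[OF v(1)])
  qed
  then show ?thesis
    unfolding pos_def_def using transpose_leading_block[OF M(1) assms(2,2)] M by auto
qed

text \<open>\<open>inj\<close> makes \<open>s I - A\<close> invertible, so
  \<open>mat_inverse\<close> returns \<open>Some\<close> and \<open>the\<close> yields the true
  inverse; the witness is the state (s I - A)^-1 \<open>B u\<close>. States are functions on
  indices, which lets systems of different order be compared coordinatewise.\<close>

lemma transfer_function_mult_vec:
  fixes A B C :: "real mat" and s :: complex
  assumes A: "A \<in> carrier_mat k k" and B: "B \<in> carrier_mat k m" and C: "C \<in> carrier_mat q k"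
    and u: "u \<in> carrier_vec m"
    and inj: "\<forall>x. (\<forall>i<k. s * x i = (\<Sum>j<k. of_real (A $$ (i,j)) * x j)) \<longrightarrow> (\<forall>i<k. x i = 0)"
  shows "\<exists>x.
    (\<forall>i<k. s * x i = (\<Sum>j<k. of_real (A $$ (i,j)) * x j) + (\<Sum>l<m. of_real (B $$ (i,l)) * u $ l)) \<and>
    (\<forall>p<q. (transfer_function A B C s *\<^sub>v u) $ p = (\<Sum>j<k. of_real (C $$ (p,j)) * x j)) \<and>
    transfer_function A B C s \<in> carrier_mat q m"
proof -
  let ?c = "map_mat complex_of_real"
  define M where "M = s \<cdot>\<^sub>m 1\<^sub>m k - ?c A"
  have M: "M \<in> carrier_mat k k" using A unfolding M_def by auto
  have Mv: "(M *\<^sub>v v) $ i = s * v $ i - (\<Sum>j<k. of_real (A $$ (i,j)) * v $ j)"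
    if "v \<in> carrier_vec k" "i < k" for v i
  proof -
    have "(M *\<^sub>v v) $ i = (\<Sum>j<k. (if i = j then s * v $ i else 0) - of_real (A $$ (i,j)) * v $ j)"
      unfolding index_mult_mat_vec_sum[OF M that]
      using that A by (intro sum.cong) (auto simp: M_def left_diff_distrib)
    then show ?thesis using that by (simp add: sum_subtractf)
  qed
  have "v = 0\<^sub>v k" if v: "v \<in> carrier_vec k" "M *\<^sub>v v = 0\<^sub>v k" for v
  proof -
    have "s * v $ i = (\<Sum>j<k. of_real (A $$ (i,j)) * v $ j)" if "i < k" for i
      using Mv[OF v(1) that] v(2) that by simp
    with inj have "\<forall>i<k. v $ i = 0" by blast
    then show ?thesis using v(1) by (intro eq_vecI) auto
  qed
  then have "det M \<noteq> 0"
    unfolding det_0_iff_vec_prod_zero_field[OF M] by blast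
  then obtain S where inv: "mat_inverse M = Some S"
    using mat_inverse(1)[OF M, of "()"] det_non_zero_imp_unit[OF M, of "()"] by (cases "mat_inverse M") auto
  from mat_inverse(2)[OF M inv] have S: "S \<in> carrier_mat k k" "M * S = 1\<^sub>m k" by auto
  have T: "transfer_function A B C s = ?c C * S * ?c B"
    using A inv unfolding transfer_function_def M_def by auto
  have cB: "?c B \<in> carrier_mat k m" and cC: "?c C \<in> carrier_mat q k" using B C by auto
  define b where "b = ?c B *\<^sub>v u"
  have b: "b \<in> carrier_vec k" unfolding b_def by (rule mult_mat_vec_carrier[OF cB u])
  define x where "x = S *\<^sub>v b"
  have x: "x \<in> carrier_vec k" unfolding x_def by (rule mult_mat_vec_carrier[OF S(1) b])
  have "M *\<^sub>v x = b"
    unfolding x_def using assoc_mult_mat_vec[OF M S(1) b] S(2) b by simp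
  then have state: "s * x $ i = (\<Sum>j<k. of_real (A $$ (i,j)) * x $ j) + (\<Sum>l<m. of_real (B $$ (i,l)) * u $ l)"
    if "i < k" for i
  proof -
    have "b $ i = (\<Sum>l<m. of_real (B $$ (i,l)) * u $ l)"
      unfolding b_def index_mult_mat_vec_sum[OF cB u that] using B that by (intro sum.cong) auto
    then show ?thesis using Mv[OF x that] \<open>M *\<^sub>v x = b\<close> by (simp add: algebra_simps)
  qed
  have y: "(transfer_function A B C s *\<^sub>v u) $ p = (\<Sum>j<k. of_real (C $$ (p,j)) * x $ j)"
    if "p < q" for p
  proof -
    have "transfer_function A B C s *\<^sub>v u = ?c C *\<^sub>v x"
      unfolding T x_def b_def
      using assoc_mult_mat_vec[OF mult_carrier_mat[OF cC S(1)] cB u]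
        assoc_mult_mat_vec[OF cC S(1) b[unfolded b_def]] by simp
    then show ?thesis
      using C that index_mult_mat_vec_sum[OF cC x that] by simp
  qed
  have "transfer_function A B C s \<in> carrier_mat q m"
    unfolding T by (rule mult_carrier_mat[OF mult_carrier_mat[OF cC S(1)] cB])
  with state y show ?thesis
    by (intro exI[of _ "($) x"] conjI allI impI)
qed

lemma hinf_norm_le:
  assumes F: "\<And>s. Re s > 0 \<Longrightarrow> F s \<in> carrier_mat q m" and b: "b \<ge> 0"
    and le: "\<And>s u. Re s > 0 \<Longrightarrow> u \<in> carrier_vec m \<Longrightarrow> euclidean_norm (F s *\<^sub>v u) \<le> b * euclidean_norm u"
  shows "hinf_norm F \<le> ereal b"
  unfolding hinf_norm_def
proof (intro SUP_least, unfold ereal_less_eq)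
  fix s assume "s \<in> {z. 0 < Re z}"
  then have s: "Re s > 0" by simp
  show "spectral_norm (F s) \<le> b"
    unfolding spectral_norm_def
  proof (rule cSUP_least)
    \<comment> \<open>The supremum is taken in the reals, so the set must be shown nonempty.\<close>
    have "euclidean_norm (0\<^sub>v m) = 0" by (auto simp: euclidean_norm_def L2_set_def)
    then show "{v \<in> carrier_vec (dim_col (F s)). euclidean_norm v \<le> 1} \<noteq> {}"
      using F[OF s] by (auto intro!: exI[of _ "0\<^sub>v m"])
  next
    fix v assume "v \<in> {v \<in> carrier_vec (dim_col (F s)). euclidean_norm v \<le> 1}"
    then have v: "v \<in> carrier_vec m" "euclidean_norm v \<le> 1" using F[OF s] by auto
    have "euclidean_norm (F s *\<^sub>v v) \<le> b * euclidean_norm v" by (rule le[OF s v(1)])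
    also have "\<dots> \<le> b" using mult_left_mono[OF v(2) b] by simp
    finally show "euclidean_norm (F s *\<^sub>v v) \<le> b" .
  qed
qed

text \<open>A diagonal right factor only scales columns, so no entry outside the leading blocks
  enters the product. For a general \<open>D\<close>, truncation does not commute with
  multiplication.\<close>

lemma leading_block_mult_diag:
  fixes M D :: "'a :: semiring_0 mat"
  assumes M: "M \<in> carrier_mat a n" and D: "D \<in> carrier_mat n n" and le: "b \<le> a" "k \<le> n"
    and diag: "\<And>i j. i < n \<Longrightarrow> j < n \<Longrightarrow> i \<noteq> j \<Longrightarrow> D $$ (i,j) = 0"
  shows "leading_block b k (M * D) = leading_block b k M * leading_block k k D"
proof (rule eq_matI)
  fix i j assume "i < dim_row (leading_block b k M * leading_block k k D)"
    and "j < dim_col (leading_block b k M * leading_block k k D)"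
  then have ij: "i < b" "j < k" by simp_all
  \<comment> \<open>Needed at \<open>n' = n\<close> for the full product and at
    \<open>n' = k\<close> for the product of blocks.\<close>
  have trunc: "(\<Sum>l<n'. M $$ (i,l) * D $$ (l,j)) = M $$ (i,j) * D $$ (j,j)" if "j < n'" "n' \<le> n" for n'
  proof -
    have "(\<Sum>l<n'. M $$ (i,l) * D $$ (l,j)) = (\<Sum>l<n'. if l = j then M $$ (i,j) * D $$ (j,j) else 0)"
      using that diag ij le by (intro sum.cong) auto
    then show ?thesis using that by simp
  qed
  have "leading_block b k (M * D) $$ (i,j) = M $$ (i,j) * D $$ (j,j)"
    using ij le index_mult_mat_sum[OF M D, of i j] trunc[of n] by simp
  also have "\<dots> = (leading_block b k M * leading_block k k D) $$ (i,j)"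
    unfolding index_mult_mat_sum[OF leading_block_carrier[of b k M] leading_block_carrier[of k k D] ij]
    using ij le trunc[of k] by simp
  finally show "leading_block b k (M * D) $$ (i,j) = (leading_block b k M * leading_block k k D) $$ (i,j)" .
qed simp_all

section \<open>The error bound by telescoping over the truncation order\<close>

lemma euclidean_norm_add_le:
  assumes "v \<in> carrier_vec n" "w \<in> carrier_vec n"
  shows "euclidean_norm (v + w) \<le> euclidean_norm v + euclidean_norm w"
proof -
  have "euclidean_norm (v + w) \<le> L2_set (\<lambda>i. cmod (v $ i) + cmod (w $ i)) {..<n}"
    unfolding euclidean_norm_def using assms
    by (auto intro!: L2_set_mono norm_triangle_ineq)
  also have "\<dots> \<le> euclidean_norm v + euclidean_norm w"
    unfolding euclidean_norm_def using assms L2_set_triangle_ineq by auto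
  finally show ?thesis .
qed

text \<open>Since the weights are diagonal, the conditions pass to the leading subsystem of every
  order \<open>k \<le> n\<close>. Thus \<open>truncation_step\<close> bounds
  \<open>G (Suc k) - G k\<close> for each \<open>k\<close> from \<open>r\<close> on, and these
  differences telescope.\<close>

lemma truncation_error_bound:
  fixes A B C :: "real mat" and d :: "nat \<Rightarrow> real" and J R :: "nat \<Rightarrow> nat \<Rightarrow> real"
  assumes A: "A \<in> carrier_mat n n" and B: "B \<in> carrier_mat n m" and C: "C \<in> carrier_mat q n"
    and d: "\<And>i. i < n \<Longrightarrow> d i > 0" and c: "c > 0" and r: "r \<le> n"
    and obs: "\<And>i j. i < n \<Longrightarrow> j < n \<Longrightarrow>
      A $$ (j,i) * d j + d i * A $$ (i,j) + (\<Sum>p<q. C $$ (p,i) * C $$ (p,j)) = 0"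
    and JR: "\<And>i j. i < n \<Longrightarrow> j < n \<Longrightarrow> A $$ (i,j) * d j = J i j - R i j"
    and J: "\<And>i j. i < n \<Longrightarrow> j < n \<Longrightarrow> J j i = - J i j"
    and RB: "\<And>k x. k \<le> n \<Longrightarrow> (\<Sum>l<m. (\<Sum>i<k. B $$ (i,l) * x i)\<^sup>2) \<le>
      2 * c * (\<Sum>i<k. x i * (\<Sum>j<k. R i j * x j))"
  shows "hinf_norm (\<lambda>s. transfer_function A B C s
      - transfer_function (leading_block r r A) (leading_block r m B) (leading_block q r C) s)
    \<le> ereal (2 * sqrt c * (\<Sum>i=r..<n. d i))"
proof -
  define G where "G k = transfer_function (leading_block k k A) (leading_block k m B) (leading_block q k C)" for k
  have obs_k: "2 * Re (\<Sum>i<k. cnj (h i) * (\<Sum>j<k. of_real (d i * A $$ (i,j)) * h j)) =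
      - (\<Sum>p<q. (cmod (\<Sum>j<k. of_real (C $$ (p,j)) * h j))\<^sup>2)" if "k \<le> n" for k h
    using that by (intro observability_identity) (auto intro: obs)
  have ctr_k: "(\<Sum>l<m. (cmod (\<Sum>i<k. of_real (B $$ (i,l)) * h i))\<^sup>2) \<le>
      - (2 * c * Re (\<Sum>i<k. cnj (h i) * (\<Sum>j<k. of_real (A $$ (i,j) * d j) * h j)))" if "k \<le> n" for k h
  proof -
    have "(\<Sum>i<k. cnj (h i) * (\<Sum>j<k. complex_of_real (A $$ (i,j) * d j) * h j)) =
      (\<Sum>i<k. cnj (h i) * (\<Sum>j<k. of_real (J i j - R i j) * h j))"
      using that JR by (intro sum.cong arg_cong2[of _ _ _ _ "(*)"] refl) simp
    then show ?thesis
      using that by (simp only:) (intro controllability_inequality, auto intro: J RB)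
  qed
  have state: "\<exists>x. (\<forall>i<k. s * x i = (\<Sum>j<k. of_real (A $$ (i,j)) * x j) + (\<Sum>l<m. of_real (B $$ (i,l)) * u $ l)) \<and>
      (\<forall>p<q. (G k s *\<^sub>v u) $ p = (\<Sum>j<k. of_real (C $$ (p,j)) * x j)) \<and> G k s \<in> carrier_mat q m"
    if s: "Re s > 0" and k: "k \<le> n" and u: "u \<in> carrier_vec m" for s k u
  proof -
    have "x i = 0" if x: "\<forall>i<k. s * x i = (\<Sum>j<k. of_real (leading_block k k A $$ (i,j)) * x j)"
      and i: "i < k" for x i
      by (rule resolvent_injective[OF s _ _ _ i, of d x "\<lambda>i j. A $$ (i,j)"])
        (use d k x obs_k[OF k] in \<open>auto simp: sum_nonneg\<close>)
    then have inj: "\<forall>x. (\<forall>i<k. s * x i = (\<Sum>j<k. of_real (leading_block k k A $$ (i,j)) * x j)) \<longrightarrow>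
      (\<forall>i<k. x i = 0)" by blast
    from transfer_function_mult_vec[OF leading_block_carrier leading_block_carrier leading_block_carrier u inj,
        of B q C]
    show ?thesis unfolding G_def by simp
  qed
  \<comment> \<open>The dimensions are part of \<open>state\<close>, which asks for some input; the
    zero vector serves.\<close>
  have G: "G k s \<in> carrier_mat q m" if "Re s > 0" "k \<le> n" for k s
    using state[OF that, of "0\<^sub>v m"] by auto
  have one_step: "euclidean_norm ((G (Suc k) s - G k s) *\<^sub>v u) \<le> 2 * sqrt c * d k * euclidean_norm u"
    if s: "Re s > 0" and k: "Suc k \<le> n" and u: "u \<in> carrier_vec m" for s k u
  proof -
    have k': "k \<le> n" using k by simp
    obtain x where
      x: "\<And>i. i < Suc k \<Longrightarrow> s * x i = (\<Sum>j<Suc k. of_real (A $$ (i,j)) * x j) + (\<Sum>l<m. of_real (B $$ (i,l)) * u $ l)"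
      and Gx: "\<And>p. p < q \<Longrightarrow> (G (Suc k) s *\<^sub>v u) $ p = (\<Sum>j<Suc k. of_real (C $$ (p,j)) * x j)"
      using state[OF s k u] by blast
    obtain z where
      z: "\<And>i. i < k \<Longrightarrow> s * z i = (\<Sum>j<k. of_real (A $$ (i,j)) * z j) + (\<Sum>l<m. of_real (B $$ (i,l)) * u $ l)"
      and Gz: "\<And>p. p < q \<Longrightarrow> (G k s *\<^sub>v u) $ p = (\<Sum>j<k. of_real (C $$ (p,j)) * z j)"
      using state[OF s k' u] by blast
    have bound: "(\<Sum>p<q. (cmod ((\<Sum>j<Suc k. of_real (C $$ (p,j)) * x j) - (\<Sum>j<k. of_real (C $$ (p,j)) * z j)))\<^sup>2)
      \<le> 4 * c * (d k)\<^sup>2 * (\<Sum>l<m. (cmod (u $ l))\<^sup>2)"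
      using s d k c
      by (intro truncation_step[OF _ _ c x z eq_refl[OF obs_k[OF k]] ctr_k[OF k]]) auto
    have "(G (Suc k) s - G k s) *\<^sub>v u = G (Suc k) s *\<^sub>v u - G k s *\<^sub>v u"
      by (rule minus_mult_distrib_mat_vec[OF G[OF s k] G[OF s k'] u])
    then have "euclidean_norm ((G (Suc k) s - G k s) *\<^sub>v u) =
      sqrt (\<Sum>p<q. (cmod ((\<Sum>j<Suc k. of_real (C $$ (p,j)) * x j) - (\<Sum>j<k. of_real (C $$ (p,j)) * z j)))\<^sup>2)"
      using G[OF s k] G[OF s k'] Gx Gz
      by (simp add: euclidean_norm_def L2_set_def del: sum.lessThan_Suc)
    also have "\<dots> \<le> sqrt (4 * c * (d k)\<^sup>2 * (\<Sum>l<m. (cmod (u $ l))\<^sup>2))"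
      using bound by (rule real_sqrt_le_mono)
    \<comment> \<open>Positivity of \<open>d k\<close> removes the absolute value left by the root
      of its square.\<close>
    also have "\<dots> = 2 * sqrt c * d k * euclidean_norm u"
      using u d[of k] k by (simp add: real_sqrt_mult euclidean_norm_def L2_set_def)
    finally show ?thesis .
  qed
  have tele: "euclidean_norm ((G k s - G r s) *\<^sub>v u) \<le> 2 * sqrt c * (\<Sum>i=r..<k. d i) * euclidean_norm u"
    if s: "Re s > 0" and "r \<le> k" "k \<le> n" and u: "u \<in> carrier_vec m" for s k u
    using that(2,3)
  proof (induction k rule: dec_induct)
    case base
    have "(G r s - G r s) *\<^sub>v u = 0\<^sub>v q"
      using G[OF s r] u by auto
    then show ?case by (simp add: euclidean_norm_def L2_set_def)
  next
    case (step k)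
    then have k: "k \<le> n" by simp
    have eq: "G (Suc k) s - G r s = (G (Suc k) s - G k s) + (G k s - G r s)"
      using G[OF s step.prems] G[OF s k] G[OF s r] by (intro eq_matI) auto
    have "(G (Suc k) s - G r s) *\<^sub>v u = (G (Suc k) s - G k s) *\<^sub>v u + (G k s - G r s) *\<^sub>v u"
      unfolding eq
      by (rule add_mult_distrib_mat_vec[OF minus_carrier_mat[OF G[OF s k]] minus_carrier_mat[OF G[OF s r]] u])
    then have "euclidean_norm ((G (Suc k) s - G r s) *\<^sub>v u) \<le>
      euclidean_norm ((G (Suc k) s - G k s) *\<^sub>v u) + euclidean_norm ((G k s - G r s) *\<^sub>v u)"
      using euclidean_norm_add_le[OF mult_mat_vec_carrier[OF minus_carrier_mat[OF G[OF s k]] u]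
          mult_mat_vec_carrier[OF minus_carrier_mat[OF G[OF s r]] u]] by simp
    also have "\<dots> \<le> 2 * sqrt c * d k * euclidean_norm u + 2 * sqrt c * (\<Sum>i=r..<k. d i) * euclidean_norm u"
      using one_step[OF s step.prems u] step.IH[OF k] by (rule add_mono)
    also have "\<dots> = 2 * sqrt c * (\<Sum>i=r..<Suc k. d i) * euclidean_norm u"
      using \<open>r \<le> k\<close> by (simp add: distrib_left distrib_right)
    finally show ?case .
  qed
  have "hinf_norm (\<lambda>s. G n s - G r s) \<le> ereal (2 * sqrt c * (\<Sum>i=r..<n. d i))"
  proof (rule hinf_norm_le)
    show "G n s - G r s \<in> carrier_mat q m" if "Re s > 0" for s
      by (rule minus_carrier_mat[OF G[OF that r]])
    show "0 \<le> 2 * sqrt c * (\<Sum>i=r..<n. d i)"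
      using c d by (intro mult_nonneg_nonneg sum_nonneg) (auto simp: less_imp_le)
    show "euclidean_norm ((G n s - G r s) *\<^sub>v u) \<le> 2 * sqrt c * (\<Sum>i=r..<n. d i) * euclidean_norm u"
      if "Re s > 0" "u \<in> carrier_vec m" for s u
      by (rule tele[OF that(1) r order_refl that(2)])
  qed
  then show ?thesis
    unfolding G_def using leading_block_self[OF A] leading_block_self[OF B] leading_block_self[OF C] by simp
qed

section \<open>Application to the balanced port-Hamiltonian system\<close>

theorem corollary12:
  fixes n m r :: nat
    and J R Q A B C Lc Mo :: "real mat"
    and \<pi> :: "nat \<Rightarrow> real"
    and c :: real
  assumes ph: "ph_representation n m J R Q A B C"
    and stable: "asymptotically_stable A"
    and minimal: "controllable A B" "observable A C"
    and Lc: "Lc \<in> carrier_mat n n"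
      "A * Lc + Lc * transpose_mat A + 2 \<cdot>\<^sub>m R = 0\<^sub>m n n"
    and Mo: "Mo \<in> carrier_mat n n"
      "transpose_mat A * Mo + Mo * A + transpose_mat C * C = 0\<^sub>m n n"
    and balanced: "Mo = Lc" "Lc = mat_diag n (\<lambda>i. \<pi> (i + 1))"
    and r: "r \<le> n"
    and c: "0 < c" "pos_semidef n (c \<cdot>\<^sub>m R - (1 / 2) \<cdot>\<^sub>m (B * transpose_mat B))"
  shows "hinf_norm (\<lambda>s. transfer_function A B C s
           - transfer_function (leading_block r r A) (leading_block r m B) (leading_block m r C) s)
         \<le> ereal (2 * sqrt c * (\<Sum>i = r + 1..n. \<pi> i))
       \<and> port_hamiltonian r m (leading_block r r A) (leading_block r m B) (leading_block m r C)"
proof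
  \<comment> \<open>The weights \<open>\<pi>\<close> are counted from 1, matrix indices from
    0.\<close>
  define d where "d i = \<pi> (i + 1)" for i
  have J: "J \<in> carrier_mat n n" "transpose_mat J = - J"
    and R: "R \<in> carrier_mat n n" "pos_semidef n R"
    and Q: "Q \<in> carrier_mat n n" "pos_def n Q"
    and B: "B \<in> carrier_mat n m"
    and A_eq: "A = (J - R) * Q" and C_eq: "C = transpose_mat B * Q"
    using ph by (auto simp: ph_representation_def pos_semidef_def pos_def_def)
  have JR: "J - R \<in> carrier_mat n n" by (rule minus_carrier_mat[OF R(1)])
  have BT: "transpose_mat B \<in> carrier_mat m n" using B by simp
  have A: "A \<in> carrier_mat n n" unfolding A_eq by (rule mult_carrier_mat[OF JR Q(1)])
  have C: "C \<in> carrier_mat m n" unfolding C_eq by (rule mult_carrier_mat[OF BT Q(1)])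
  have Lc_d: "Lc = mat_diag n d" unfolding balanced(2) d_def by simp
  have QL: "Q * mat_diag n d = 1\<^sub>m n"
    using controllability_gramian_eq_inverse[OF ph stable Lc] unfolding Lc_d .
  have Qd: "Q $$ (i,j) * d j = (if i = j then 1 else 0)" if "i < n" "j < n" for i j
  proof -
    have "(Q * mat_diag n d) $$ (i,j) = 1\<^sub>m n $$ (i,j)" unfolding QL ..
    then show ?thesis using that by (simp add: mat_diag_mult_right[OF Q(1)])
  qed
  \<comment> \<open>Positivity of the weights is derived: the diagonal entries of \<open>Q\<close>
    are positive, and \<open>Q $$ (i,i) * d i = 1\<close>.\<close>
  have d_pos: "d i > 0" if i: "i < n" for i
  proof -
    have "unit_vec n i \<bullet> (Q *\<^sub>v unit_vec n i) = Q $$ (i,i)"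
      using scalar_prod_left_unit[OF mult_mat_vec_carrier[OF Q(1) unit_vec_carrier] i]
        scalar_prod_right_unit[OF i, of "row Q i"] i Q(1) by simp
    moreover have "0 < unit_vec n i \<bullet> (Q *\<^sub>v unit_vec n i)"
      using Q(2) i unfolding pos_def_def by (simp add: unit_vec_nonzero)
    ultimately show ?thesis using Qd[OF i i] zero_less_mult_pos[of "Q $$ (i,i)" "d i"] by simp
  qed
  \<comment> \<open>Off the diagonal \<open>Q $$ (i,j) * d j = 0\<close>, and \<open>d j\<close> is
    nonzero.\<close>
  have Q_diag: "Q $$ (i,j) = 0" if "i < n" "j < n" "i \<noteq> j" for i j
    using Qd[OF that(1,2)] d_pos[OF that(2)] that(3) by simp
  have Ad: "A $$ (i,j) * d j = J $$ (i,j) - R $$ (i,j)" if "i < n" "j < n" for i j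
  proof -
    have "A * mat_diag n d = (J - R) * (Q * mat_diag n d)"
      unfolding A_eq by (rule assoc_mult_mat[OF JR Q(1) mat_diag_dim])
    also have "\<dots> = J - R"
      unfolding QL by (rule right_mult_one_mat[OF JR])
    finally have "(A * mat_diag n d) $$ (i,j) = (J - R) $$ (i,j)" by simp
    then show ?thesis using that J(1) R(1) by (simp add: mat_diag_mult_right[OF A])
  qed
  have J_skew: "J $$ (j,i) = - J $$ (i,j)" if "i < n" "j < n" for i j
    using arg_cong[OF J(2), of "\<lambda>M. M $$ (i,j)"] that J(1) by simp
  have obs: "A $$ (j,i) * d j + d i * A $$ (i,j) + (\<Sum>p<m. C $$ (p,i) * C $$ (p,j)) = 0"
    if "i < n" "j < n" for i j
  proof -
    have "(transpose_mat C * C) $$ (i,j) = (\<Sum>p<m. C $$ (p,i) * C $$ (p,j))"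
      using index_mult_mat_sum[of "transpose_mat C" n m C n i j] C that by simp
    moreover have "(transpose_mat A * mat_diag n d) $$ (i,j) = A $$ (j,i) * d j"
      using that A by (simp add: mat_diag_mult_right[of _ n n])
    moreover have "(mat_diag n d * A) $$ (i,j) = d i * A $$ (i,j)"
      using that A by (simp add: mat_diag_mult_left[of _ n n])
    moreover have "(transpose_mat A * mat_diag n d + mat_diag n d * A + transpose_mat C * C) $$ (i,j) = 0"
      using Mo(2) that unfolding balanced(1) Lc_d by simp
    ultimately show ?thesis using that A C mat_diag_dim[of n d]
      by (simp del: index_mult_mat(1))
  qed
  \<comment> \<open>The condition on \<open>c\<close>, tested with vectors supported on the first
    \<open>k\<close> coordinates; the factor 2 clears the \<open>1 / 2\<close> in front of
    \<open>B * transpose_mat B\<close>.\<close>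
  have RB: "(\<Sum>l<m. (\<Sum>i<k. B $$ (i,l) * x i)\<^sup>2) \<le> 2 * c * (\<Sum>i<k. x i * (\<Sum>j<k. R $$ (i,j) * x j))"
    if k: "k \<le> n" for k x
  proof -
    have "(c \<cdot>\<^sub>m R - (1 / 2) \<cdot>\<^sub>m (B * transpose_mat B)) $$ (i,j) =
      c * R $$ (i,j) - (\<Sum>l<m. B $$ (i,l) * B $$ (j,l)) / 2" if "i < k" "j < k" for i j
      using that k R(1) B index_mult_mat_sum[OF B BT, of i j] by simp
    then have "(\<Sum>i<k. x i * (\<Sum>j<k. (c \<cdot>\<^sub>m R - (1 / 2) \<cdot>\<^sub>m (B * transpose_mat B)) $$ (i,j) * x j)) =
      (\<Sum>i<k. x i * (\<Sum>j<k. (c * R $$ (i,j) - (\<Sum>l<m. B $$ (i,l) * B $$ (j,l)) / 2) * x j))"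
      by (intro sum.cong arg_cong2[of _ _ _ _ "(*)"] refl) simp
    also have "\<dots> = c * (\<Sum>i<k. x i * (\<Sum>j<k. R $$ (i,j) * x j)) -
      (\<Sum>i<k. x i * (\<Sum>j<k. (\<Sum>l<m. B $$ (i,l) * B $$ (j,l)) * x j)) / 2"
      by (simp add: left_diff_distrib right_diff_distrib sum_subtractf sum_distrib_left
          sum_divide_distrib mult_ac)
    also have "(\<Sum>i<k. x i * (\<Sum>j<k. (\<Sum>l<m. B $$ (i,l) * B $$ (j,l)) * x j)) =
      (\<Sum>l<m. (\<Sum>i<k. B $$ (i,l) * x i)\<^sup>2)"
      by (rule quadratic_form_gram)
    finally show ?thesis
      using pos_semidef_leading_sum[OF c(2) k, of x] by simp
  qed
  have "(\<Sum>i=r..<n. d i) = (\<Sum>i=r+1..n. \<pi> i)"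
    unfolding d_def by (simp add: sum.shift_bounds_Suc_ivl[symmetric] atLeastLessThanSuc_atLeastAtMost)
  with truncation_error_bound[OF A B C d_pos c(1) r obs Ad J_skew RB]
  show "hinf_norm (\<lambda>s. transfer_function A B C s
      - transfer_function (leading_block r r A) (leading_block r m B) (leading_block m r C) s)
    \<le> ereal (2 * sqrt c * (\<Sum>i = r + 1..n. \<pi> i))"
    by simp
  \<comment> \<open>Because \<open>Q\<close> is diagonal, truncating \<open>A\<close> and
    \<open>C\<close> amounts to truncating \<open>J\<close>, \<open>R\<close>, \<open>B\<close> and
    \<open>Q\<close> separately.\<close>
  have "leading_block r r A = (leading_block r r J - leading_block r r R) * leading_block r r Q"
  proof -
    have "leading_block r r (J - R) = leading_block r r J - leading_block r r R"
      using J(1) R(1) r by (intro eq_matI) auto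
    then show ?thesis
      unfolding A_eq using leading_block_mult_diag[OF JR Q(1) r r Q_diag] by simp
  qed
  moreover have "leading_block m r C = transpose_mat (leading_block r m B) * leading_block r r Q"
    unfolding C_eq transpose_leading_block[OF B r order_refl]
    by (rule leading_block_mult_diag[OF BT Q(1) order_refl r Q_diag])
  moreover have "transpose_mat (leading_block r r J) = - leading_block r r J"
    unfolding transpose_leading_block[OF J(1) r r] J(2) using J(1) r by (intro eq_matI) auto
  ultimately show "port_hamiltonian r m (leading_block r r A) (leading_block r m B) (leading_block m r C)"
    unfolding port_hamiltonian_def ph_representation_def
    using pos_semidef_leading_block[OF R(2) r] pos_def_leading_block[OF Q(2) r] leading_block_carrier
    by blast
qed

end
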